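(* For $t\in[1,2]$, $$N(t)=e^{\frac{e}{e-1}t}\left(-\frac{e-1}{e^{2+\frac{1}{e-1}}}+\frac{1}{e}+\frac{e^{-\frac{e}{e-1}}}{e-1}\right)+\frac{2(e-1)}{e}-\frac{e^{-\frac{e}{e-1}}\,t\,e^{\frac{e}{e-1}t}}{e-1}.$$
   Context: For real $t\ge 0$, $N(t)$ denotes the expected number of selections when numbers are selected independently and uniformly at random from $[1,e]$ until their product is greater than $e^t$. That is, $N(t)$ is the expected value of $\min\{n\ge 1: Z_1Z_2\cdots Z_n>e^t\}$, where $Z_1,Z_2,\ldots$ are i.i.d. uniform on $[1,e]$. *)

theory Defs
  imports "HOL-Probability.Probability"
begin

text \<open>
  The number of selections takes values in \<^typ>\<open>enat\<close>: if the partial products never exceed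
  \<^term>\<open>exp t\<close>, it is the infimum of the empty set, that is \<^term>\<open>\<infinity> :: enat\<close>. Accordingly its
  expected value is a nonnegative Lebesgue integral, so that finiteness of the expectation is
  part of any claim that it equals a real number.
\<close>

definition num_selections :: "(nat \<Rightarrow> real) \<Rightarrow> real \<Rightarrow> enat" where
  "num_selections z t = Inf (enat ` {n. 1 \<le> n \<and> (\<Prod>i=1..n. z i) > exp t})"

definition expected_selections :: "'a measure \<Rightarrow> (nat \<Rightarrow> 'a \<Rightarrow> real) \<Rightarrow> real \<Rightarrow> ennreal" where
  "expected_selections M Z t =
    (\<integral>\<^sup>+ \<omega>. ennreal_of_enat (num_selections (\<lambda>i. Z i \<omega>) t) \<partial>M)"

end

theory Submission
  imports Defs
begin

text \<open>
  Write \<open>h t\<close> for the expected number of selections and \<open>a = e / (e - 1)\<close>. Conditioning on the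
  first selection gives the renewal equation
  \<open>h t = 1 + (1 / (e - 1)) * (integral of h (t - ln z) over z from 1 to e)\<close> for \<open>t \<ge> 0\<close>, where
  \<open>h\<close> is \<open>0\<close> on negative arguments. Differentiating, this becomes the delay equation
  \<open>h' t = a * h t - 1 - a * h (t - 1)\<close>, which can be solved one unit interval after the other:
  on \<open>[0, 1]\<close> the solution is \<^term>\<open>early\<close>, on \<open>[1, 2]\<close> it is \<^term>\<open>late\<close>, and the latter is the
  claimed formula.

  The proof takes this solution as a candidate and verifies it, which settles finiteness and
  uniqueness at the same time. It is written in the multiplicative variable \<open>x = exp t\<close>, in which
  the candidate is \<^term>\<open>profile\<close> and the selections are used without taking logarithms. Let \<open>P n\<close> be
  the product of the first \<open>n\<close> selections. The renewal equation (\<open>profile_renewal\<close>) and the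
  independence of \<open>P n\<close> from the next selection give
  \<open>E (profile (x / P n)) = Pr (P n \<le> x) + E (profile (x / P (n + 1)))\<close>.
  Starting from \<open>P 0 = 1\<close> this telescopes: \<open>profile x\<close> is the sum of \<open>Pr (P i \<le> x)\<close> over \<open>i < n\<close>
  plus the remainder \<open>E (profile (x / P n))\<close>. Almost surely all arguments \<open>x / P n\<close> are at most
  \<open>exp 2\<close>, and there \<^term>\<open>profile\<close> is nonnegative and at most a constant times the indicator of
  \<open>[1, \<infinity>)\<close>. By nonnegativity the series converges, so its terms tend to \<open>0\<close>; by the upper bound
  the remainder is at most that constant times \<open>Pr (P n \<le> x)\<close> and tends to \<open>0\<close> as well.
  Hence \<open>profile x\<close> is the sum of the whole series. All selections are almost surely at least
  \<open>1\<close>, so more than \<open>n\<close> of them are needed exactly when \<open>P n \<le> x\<close>, and the series is the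
  expectation in question.
\<close>

section \<open>The candidate for the expectation\<close>

text \<open>
  On the first two unit intervals the solution of the delay equation has this form: the homogeneous
  solution grows at rate \<open>e / (e - 1)\<close>, and on the second interval the delayed term grows at the
  same rate; this resonance is where the linear factor comes from.
\<close>

definition exp_affine :: "real \<Rightarrow> real \<Rightarrow> real \<Rightarrow> real \<Rightarrow> real" where
  "exp_affine \<alpha> \<beta> \<gamma> s = \<alpha> + exp (exp 1 / (exp 1 - 1) * s) * (\<beta> + \<gamma> * s)"

definition early :: "real \<Rightarrow> real" where
  "early = exp_affine ((exp 1 - 1) / exp 1) (1 / exp 1) 0"

text \<open>
  The coefficient of the homogeneous solution is fixed by continuity at \<open>1\<close>.
\<close>

definition late :: "real \<Rightarrow> real" where
  "late = exp_affine (2 * (exp 1 - 1) / exp 1)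
     (1 / exp 1 - exp (- (exp 1 / (exp 1 - 1))) * ((exp 1 - 1) / exp 1 - 1 / (exp 1 - 1)))
     (- exp (- (exp 1 / (exp 1 - 1))) / (exp 1 - 1))"

text \<open>
  The candidate as a function of \<open>x = exp t\<close>. The value \<open>0\<close> below \<open>1\<close> encodes that no further
  selection is counted once the threshold has been passed.
\<close>

definition profile :: "real \<Rightarrow> real" where
  "profile x = (if x < 1 then 0 else if x \<le> exp 1 then early (ln x) else late (ln x))"

lemma early_1_eq_late_1: "early 1 = late 1"
proof -
  define e E :: real where "e = exp 1" and "E = exp (e / (e - 1))"
  have "E * inverse E = 1" "e * inverse e = 1" "(e - 1) * inverse (e - 1) = 1"
    by (simp_all add: e_def E_def)
  then have "(e - 1) / e + E * (1 / e + 0 * 1) = 2 * (e - 1) / e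
      + E * (1 / e - inverse E * ((e - 1) / e - 1 / (e - 1)) + - inverse E / (e - 1) * 1)"
    unfolding divide_inverse by algebra
  then show ?thesis
    by (simp only: early_def late_def exp_affine_def E_def e_def exp_minus mult_1_right)
qed

lemma early_nonneg: "early s \<ge> 0"
  by (simp add: early_def exp_affine_def)

text \<open>
  Centring the affine factor of \<^term>\<open>late\<close> at \<open>s = 1\<close> exposes its sign.
\<close>

lemma late_bracket_eq:
  fixes e :: real and a s :: real
  assumes "e > 1" "a = e / (e - 1)"
  shows "1 / e - exp (- a) * ((e - 1) / e - 1 / (e - 1)) + (- exp (- a) / (e - 1)) * s
    = (1 - exp (- a) * (e - 1 + e / (e - 1) * (s - 1))) / e"
proof -
  have "e * inverse e = 1" "(e - 1) * inverse (e - 1) = 1"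
    using assms by auto
  then show ?thesis
    unfolding divide_inverse by algebra
qed

text \<open>
  The affine factor of \<^term>\<open>late\<close> decreases, so its sign is decided at \<open>s = 2\<close>, where
  nonnegativity amounts to \<open>e - 1 + a \<le> exp a\<close>. This holds because
  \<open>exp a = e * exp (a - 1) \<ge> e * a = e + a\<close>. For the upper bound any constant will do.
\<close>

lemma late_bounds:
  assumes "1 \<le> s" "s \<le> 2"
  shows "late s \<ge> 0" and "late s \<le> 2 + exp (2 * (exp 1 / (exp 1 - 1)))"
proof -
  define e :: real where "e = exp 1"
  define a where "a = e / (e - 1)"
  have e: "e > 1" by (simp add: e_def)
  then have a: "a > 0" "a * (e - 1) = e" by (simp_all add: a_def)
  have "e - 1 + a \<le> exp a"
  proof -
    have "e - 1 + a \<le> e * a"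
      using a(2) e by (simp add: algebra_simps)
    also have "\<dots> \<le> e * exp (a - 1)"
      using e exp_ge_add_one_self[of "a - 1"] by (intro mult_left_mono) auto
    also have "\<dots> = exp a"
      by (simp add: e_def flip: exp_add)
    finally show ?thesis .
  qed
  moreover have "e - 1 + a * (s - 1) \<le> e - 1 + a"
    using a(1) assms by (simp add: mult_left_le)
  ultimately have "exp (- a) * (e - 1 + a * (s - 1)) \<le> exp (- a) * exp a"
    by (intro mult_left_mono) auto
  then have le: "exp (- a) * (e - 1 + a * (s - 1)) \<le> 1"
    by (simp add: flip: exp_add)
  have ge: "exp (- a) * (e - 1 + a * (s - 1)) \<ge> 0"
    using e a assms by (intro mult_nonneg_nonneg) auto
  have eq: "late s = 2 * (e - 1) / e
      + exp (a * s) * ((1 - exp (- a) * (e - 1 + a * (s - 1))) / e)"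
    unfolding late_def exp_affine_def e_def[symmetric] a_def[symmetric]
    using late_bracket_eq[OF e a_def, of s] by (simp only: a_def[symmetric])
  show "late s \<ge> 0"
    unfolding eq using e le by (intro add_nonneg_nonneg mult_nonneg_nonneg divide_nonneg_pos) auto
  have "exp (a * s) * ((1 - exp (- a) * (e - 1 + a * (s - 1))) / e) \<le> exp (2 * a) * 1"
    using e le ge a assms by (intro mult_mono) (auto simp: field_simps)
  moreover have "2 * (e - 1) / e \<le> 2"
    using e by (simp add: field_simps)
  ultimately show "late s \<le> 2 + exp (2 * (exp 1 / (exp 1 - 1)))"
    unfolding eq e_def[symmetric] a_def[symmetric] by simp
qed

lemma early_le:
  assumes "s \<le> 1"
  shows "early s \<le> 2 + exp (2 * (exp 1 / (exp 1 - 1)))"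
proof -
  define e :: real where "e = exp 1"
  define a where "a = e / (e - 1)"
  have e: "e > 1" by (simp add: e_def)
  then have a: "a > 0" by (simp add: a_def)
  have "exp (a * s) * (1 / e) \<le> exp (2 * a) * 1"
    using e a assms by (intro mult_mono) (auto simp: field_simps intro: order_trans[of _ a])
  moreover have "(e - 1) / e \<le> 2"
    using e by (simp add: field_simps)
  ultimately show ?thesis
    unfolding early_def exp_affine_def e_def[symmetric] a_def[symmetric] by simp
qed

text \<open>
  The indicator in the upper bound is what later ties the remainder of the telescoped sum to
  the probability that the threshold has not been passed.
\<close>

lemma profile_bounds:
  assumes "x \<le> exp 2"
  shows "0 \<le> profile x"
    and "profile x \<le> (2 + exp (2 * (exp 1 / (exp 1 - 1)))) * indicator {1..} x"
proof -
  have ln: "1 \<le> ln x \<and> ln x \<le> 2" if "x > exp 1"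
  proof -
    have "x > 0" using that by (meson exp_gt_zero less_trans)
    then show ?thesis
      using assms that by (metis exp_le_cancel_iff exp_ln less_imp_le)
  qed
  have ln': "ln x \<le> 1" if "x \<ge> 1" "x \<le> exp 1"
    using that by (metis exp_le_cancel_iff exp_ln less_le_trans zero_less_one)
  show "0 \<le> profile x"
    using early_nonneg late_bounds(1) ln by (auto simp: profile_def not_le)
  show "profile x \<le> (2 + exp (2 * (exp 1 / (exp 1 - 1)))) * indicator {1..} x"
    using early_le[of "ln x"] late_bounds(2)[of "ln x"] ln ln'
    by (auto simp: profile_def not_le indicator_def)
qed

lemma profile_measurable [measurable]: "profile \<in> borel_measurable borel"
  unfolding profile_def [abs_def] early_def late_def exp_affine_def by measurable


section \<open>The renewal equation\<close>

definition exp_affine_primitive :: "real \<Rightarrow> real \<Rightarrow> real \<Rightarrow> real \<Rightarrow> real \<Rightarrow> real" where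
  "exp_affine_primitive \<alpha> \<beta> \<gamma> y z =
     \<alpha> * z - (exp 1 - 1) * z * exp (exp 1 / (exp 1 - 1) * (ln y - ln z)) *
       (\<beta> + \<gamma> * (ln y - ln z - (exp 1 - 1)))"

text \<open>
  Because \<open>(e - 1) * (e / (e - 1) - 1) = 1\<close>, the factor \<open>- (e - 1) * z\<close> in front of the exponential
  undoes its differentiation; the shift by \<open>e - 1\<close> in the affine factor compensates for the
  derivative of that factor.
\<close>

lemma exp_affine_primitive_deriv:
  assumes "z > 0" "y > 0"
  shows "(exp_affine_primitive \<alpha> \<beta> \<gamma> y has_real_derivative exp_affine \<alpha> \<beta> \<gamma> (ln (y / z))) (at z)"
proof -
  define e :: real where "e = exp 1"
  define a where "a = e / (e - 1)"
  have e: "e > 1" by (simp add: e_def)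
  then have a: "a * (e - 1) = e" by (simp add: a_def)
  define X where "X = exp (a * (ln y - ln z))"
  have "((\<lambda>z. \<alpha> * z - (e - 1) * z * exp (a * (ln y - ln z)) * (\<beta> + \<gamma> * (ln y - ln z - (e - 1))))
    has_real_derivative (\<alpha> - ((e - 1) * X + (e - 1) * z * (X * (a * (- (1 / z))))) *
      (\<beta> + \<gamma> * (ln y - ln z - (e - 1))) - (e - 1) * z * X * (\<gamma> * (- (1 / z))))) (at z)"
    unfolding X_def using assms by (auto intro!: derivative_eq_intros simp: field_simps)
  (* the two factors z and 1 / z cancel, and a * (e - 1) = e turns the coefficient into -1 *)
  also have "(e - 1) * X + (e - 1) * z * (X * (a * (- (1 / z)))) = (e - 1 - a * (e - 1)) * X"
    using assms by (simp add: field_simps)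
  also have "(e - 1) * z * X * (\<gamma> * (- (1 / z))) = - (e - 1) * X * \<gamma>"
    using assms by (simp add: field_simps)
  also have "\<alpha> - (e - 1 - a * (e - 1)) * X * (\<beta> + \<gamma> * (ln y - ln z - (e - 1)))
      - - (e - 1) * X * \<gamma> = \<alpha> + X * (\<beta> + \<gamma> * (ln y - ln z))"
    unfolding a by (simp add: algebra_simps)
  also have "\<dots> = exp_affine \<alpha> \<beta> \<gamma> (ln (y / z))"
    using assms by (simp add: exp_affine_def X_def a_def e_def ln_div)
  finally show ?thesis
    unfolding exp_affine_primitive_def [abs_def] e_def a_def .
qed

text \<open>
  The integrand is prescribed on the open interval only, so that the pieces of \<^term>\<open>profile\<close> can be
  integrated up to the points where they meet, whatever its values there.
\<close>

lemma has_integral_exp_affine: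
  assumes "0 < p" "p \<le> q" "y > 0"
    and "\<And>z. z \<in> {p<..<q} \<Longrightarrow> f z = exp_affine \<alpha> \<beta> \<gamma> (ln (y / z))"
  shows "(f has_integral exp_affine_primitive \<alpha> \<beta> \<gamma> y q - exp_affine_primitive \<alpha> \<beta> \<gamma> y p) {p..q}"
proof (rule fundamental_theorem_of_calculus_interior[OF \<open>p \<le> q\<close>])
  show "continuous_on {p..q} (exp_affine_primitive \<alpha> \<beta> \<gamma> y)"
  proof (rule DERIV_continuous_on)
    fix z assume "z \<in> {p..q}"
    then have "z > 0" using assms by simp
    from exp_affine_primitive_deriv[OF this \<open>y > 0\<close>]
    show "(exp_affine_primitive \<alpha> \<beta> \<gamma> y has_real_derivative exp_affine \<alpha> \<beta> \<gamma> (ln (y / z)))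
        (at z within {p..q})"
      by (rule has_field_derivative_at_within)
  qed
next
  fix z assume "z \<in> {p<..<q}"
  then show "(exp_affine_primitive \<alpha> \<beta> \<gamma> y has_vector_derivative f z) (at z)"
    using exp_affine_primitive_deriv[of z y] assms
    by (simp add: has_real_derivative_iff_has_vector_derivative)
qed

text \<open>
  For \<open>y \<le> e\<close> the selections \<open>z > y\<close> pass the threshold at once and contribute \<open>0\<close>; the others
  leave a quotient \<open>y / z\<close> in the range of \<^term>\<open>early\<close>.
\<close>

lemma profile_integral_early:
  assumes "1 \<le> y" "y \<le> exp 1"
  shows "((\<lambda>z. profile (y / z)) has_integral (exp 1 - 1) * (profile y - 1)) {1..exp 1}"
proof -
  define e :: real where "e = exp 1"
  define W where "W = exp (e / (e - 1) * ln y)"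
  have e: "e > 1" by (simp add: e_def)
  let ?F = "exp_affine_primitive ((exp 1 - 1) / exp 1) (1 / exp 1) 0 y"
  have "((\<lambda>z. profile (y / z)) has_integral ?F y - ?F 1) {1..y}"
  proof (rule has_integral_exp_affine)
    fix z :: real assume z: "z \<in> {1<..<y}"
    then have "y / z > 1" "y / z \<le> exp 1"
      using assms by (auto simp: field_simps intro: order_trans[of _ "exp 1"])
    then show "profile (y / z) = exp_affine ((exp 1 - 1) / exp 1) (1 / exp 1) 0 (ln (y / z))"
      by (simp add: profile_def early_def)
  qed (use assms in auto)
  moreover have "((\<lambda>z. profile (y / z)) has_integral 0) {y..exp 1}"
  proof -
    (* the zero function is the instance of exp_affine with vanishing coefficients *)
    have "((\<lambda>z. profile (y / z)) has_integral
        exp_affine_primitive 0 0 0 y (exp 1) - exp_affine_primitive 0 0 0 y y) {y..exp 1}"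
    proof (rule has_integral_exp_affine)
      fix z assume "z \<in> {y<..<exp 1}"
      then have "y / z < 1" using assms by simp
      then show "profile (y / z) = exp_affine 0 0 0 (ln (y / z))"
        by (simp add: profile_def exp_affine_def)
    qed (use assms in auto)
    then show ?thesis by (simp add: exp_affine_primitive_def)
  qed
  ultimately have "((\<lambda>z. profile (y / z)) has_integral ?F y - ?F 1 + 0) {1..exp 1}"
    by (rule has_integral_combine[rotated 2]) (use assms in auto)
  moreover have "?F y = (e - 1) / e * y - (e - 1) * y / e" "?F 1 = (e - 1) / e - (e - 1) * W / e"
    using assms by (simp_all add: exp_affine_primitive_def e_def W_def)
  moreover have "profile y = (e - 1) / e + W / e"
    using assms by (simp add: profile_def early_def exp_affine_def e_def W_def)
  moreover have "(e - 1) / e * y - (e - 1) * y / e - ((e - 1) / e - (e - 1) * W / e) + 0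
      = (e - 1) * ((e - 1) / e + W / e - 1)"
    using e by (simp add: field_simps)
  ultimately show ?thesis
    by (simp add: e_def)
qed

text \<open>
  The identity behind the renewal equation on the second interval, with \<open>E\<close> for \<open>exp a\<close>, \<open>T\<close>
  for \<open>ln y\<close> and \<open>W\<close> for \<open>exp (a * T)\<close>. It is polynomial in these quantities and in the inverses of
  \<open>E\<close>, \<open>e\<close> and \<open>e - 1\<close>. The value of \<open>\<gamma>\<close> makes the terms with \<open>W\<close> agree, and with it
  that of \<open>\<beta>\<close> makes the terms with \<open>y\<close> cancel.
\<close>

lemma late_renewal_algebra:
  fixes e E T W y :: real
  assumes "e > 1" "E > 0"
  defines "\<beta> \<equiv> 1 / e - inverse E * ((e - 1) / e - 1 / (e - 1))"
    and "\<gamma> \<equiv> - inverse E / (e - 1)"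
  shows "((2 * (e - 1) / e * (y / e) - (e - 1) * (y / e) * E * (\<beta> + \<gamma> * (1 - (e - 1))))
      - (2 * (e - 1) / e - (e - 1) * W * (\<beta> + \<gamma> * (T - (e - 1)))))
    + (((e - 1) / e * e - (e - 1) * e * (W * inverse E) * (1 / e))
      - ((e - 1) / e * (y / e) - (e - 1) * (y / e) * E * (1 / e)))
    = (e - 1) * (2 * (e - 1) / e + W * (\<beta> + \<gamma> * T) - 1)"
proof -
  have "E * inverse E = 1" "(e - 1) * inverse (e - 1) = 1" "e * inverse e = 1"
    using assms by auto
  then show ?thesis
    unfolding \<beta>_def \<gamma>_def divide_inverse by algebra
qed

text \<open>
  For \<open>e < y \<le> e\<^sup>2\<close> the integral splits at \<open>z = y / e\<close>: smaller selections leave a quotient in the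
  range of \<^term>\<open>late\<close>, larger ones a quotient in the range of \<^term>\<open>early\<close>.
\<close>

lemma profile_integral_late:
  assumes "exp 1 < y" "y \<le> exp 2"
  shows "((\<lambda>z. profile (y / z)) has_integral (exp 1 - 1) * (profile y - 1)) {1..exp 1}"
proof -
  define e :: real where "e = exp 1"
  define a where "a = e / (e - 1)"
  define W where "W = exp (a * ln y)"
  have e: "e > 1" by (simp add: e_def)
  have y: "y > 1" using assms e unfolding e_def by linarith
  have y_le: "y \<le> e * e" using assms by (simp add: e_def flip: exp_add)
  have ln_e: "ln e = 1" by (simp add: e_def)
  define \<beta> where "\<beta> = 1 / e - inverse (exp a) * ((e - 1) / e - 1 / (e - 1))"
  define \<gamma> where "\<gamma> = - inverse (exp a) / (e - 1)"
  have late: "late = exp_affine (2 * (e - 1) / e) \<beta> \<gamma>"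
    by (simp add: late_def \<beta>_def \<gamma>_def a_def e_def exp_minus)
  let ?F = "exp_affine_primitive ((e - 1) / e) (1 / e) 0 y"
  let ?G = "exp_affine_primitive (2 * (e - 1) / e) \<beta> \<gamma> y"
  have "((\<lambda>z. profile (y / z)) has_integral ?G (y / e) - ?G 1) {1..y / e}"
  proof (rule has_integral_exp_affine)
    fix z :: real assume z: "z \<in> {1<..<y / e}"
    then have "e < y / z" using y e by (auto simp: field_simps)
    then have "profile (y / z) = late (ln (y / z))"
      using e by (simp add: profile_def flip: e_def)
    then show "profile (y / z) = exp_affine (2 * (e - 1) / e) \<beta> \<gamma> (ln (y / z))"
      by (simp only: late)
  qed (use assms y e in \<open>auto simp: field_simps e_def\<close>)
  moreover have "((\<lambda>z. profile (y / z)) has_integral ?F e - ?F (y / e)) {y / e..e}"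
  proof (rule has_integral_exp_affine)
    fix z :: real assume z: "z \<in> {y / e<..<e}"
    have "z > 0" using z y e by (auto intro: less_trans[of _ "y / e"])
    then have "y / z \<le> e" "1 \<le> y / z"
      using z y e assms by (auto simp: field_simps e_def)
    then show "profile (y / z) = exp_affine ((e - 1) / e) (1 / e) 0 (ln (y / z))"
      using e by (simp add: profile_def early_def e_def)
  qed (use y_le y e in \<open>auto simp: field_simps\<close>)
  ultimately have "((\<lambda>z. profile (y / z)) has_integral
      (?G (y / e) - ?G 1) + (?F e - ?F (y / e))) {1..e}"
    by (rule has_integral_combine[rotated 2]) (use y_le assms y e in \<open>auto simp: field_simps e_def\<close>)
  moreover have "?G (y / e) = 2 * (e - 1) / e * (y / e) - (e - 1) * (y / e) * exp a * (\<beta> + \<gamma> * (1 - (e - 1)))"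
    "?F (y / e) = (e - 1) / e * (y / e) - (e - 1) * (y / e) * exp a * (1 / e)"
    using y e by (simp_all add: exp_affine_primitive_def ln_div ln_e a_def flip: e_def)
  moreover have "?G 1 = 2 * (e - 1) / e - (e - 1) * W * (\<beta> + \<gamma> * (ln y - (e - 1)))"
    by (simp add: exp_affine_primitive_def W_def a_def flip: e_def)
  moreover have "?F e = (e - 1) / e * e - (e - 1) * e * (W * inverse (exp a)) * (1 / e)"
  proof -
    have "exp (a * (ln y - ln e)) = W * inverse (exp a)"
      by (simp add: W_def ln_e right_diff_distrib exp_diff divide_inverse)
    then show ?thesis
      by (simp add: exp_affine_primitive_def a_def flip: e_def)
  qed
  moreover have "profile y = 2 * (e - 1) / e + W * (\<beta> + \<gamma> * ln y)"
    using assms y by (simp add: profile_def late exp_affine_def W_def a_def flip: e_def)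
  ultimately show ?thesis
    using late_renewal_algebra[OF e, of "exp a" y W "ln y"]
    by (simp only: \<beta>_def \<gamma>_def e_def exp_gt_zero)
qed

text \<open>
  The renewal equation. Arguments below \<open>1\<close>, where both sides vanish, are included because the
  random quotients to which the equation is applied fall there once the threshold has been passed.
\<close>

lemma profile_renewal:
  assumes "y \<le> exp 2"
  shows "ennreal (profile y) = indicator {1..} y +
    (\<integral>\<^sup>+ z. ennreal (profile (y / z)) \<partial>uniform_measure lborel {1..exp 1})"
proof -
  have div: "y / z \<le> exp 2" if "z \<in> {1..exp 1}" for z :: real
  proof (cases "y \<ge> 0")
    case True
    then have "y / z \<le> y / 1" using that by (intro divide_left_mono) auto
    with assms show ?thesis by simp
  next
    case False
    then have "y / z \<le> 0" using that by (simp add: divide_nonpos_pos)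
    then show ?thesis by (rule order_trans) simp
  qed
  have unif: "(\<integral>\<^sup>+ z. ennreal (profile (y / z)) \<partial>uniform_measure lborel {1..exp 1})
      = (\<integral>\<^sup>+ z. indicator {1..exp 1} z * ennreal (profile (y / z)) \<partial>lborel) / ennreal (exp 1 - 1)"
    by (subst nn_integral_uniform_measure) (simp_all add: mult.commute)
  show ?thesis
  proof (cases "y < 1")
    case True
    have "profile (y / z) = 0" if "z \<in> {1..exp 1}" for z
    proof -
      have "y < z" "0 < z" using that True by auto
      then show ?thesis by (simp add: profile_def)
    qed
    then have "(\<integral>\<^sup>+ z. indicator {1..exp 1} z * ennreal (profile (y / z)) \<partial>lborel) = (\<integral>\<^sup>+ z. 0 \<partial>(lborel :: real measure))"
      by (intro nn_integral_cong) (auto simp: indicator_def)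
    then show ?thesis
      unfolding unif using True by (simp add: profile_def)
  next
    case False
    have int: "((\<lambda>z. profile (y / z)) has_integral (exp 1 - 1) * (profile y - 1)) {1..exp 1}"
      using False assms profile_integral_early profile_integral_late by (cases "y \<le> exp 1") auto
    have nonneg: "(exp 1 - 1) * (profile y - 1) \<ge> 0"
      using int by (rule has_integral_nonneg) (use div profile_bounds(1) in auto)
    then have ge: "profile y - 1 \<ge> 0"
      by (simp add: zero_le_mult_iff)
    have "(\<integral>\<^sup>+ z. indicator {1..exp 1} z * ennreal (profile (y / z)) \<partial>lborel)
        = (\<integral>\<^sup>+ z. ennreal (indicator {1..exp 1} z * profile (y / z)) \<partial>lborel)"
      by (intro nn_integral_cong) (auto simp: indicator_def)
    also have "\<dots> = ennreal ((exp 1 - 1) * (profile y - 1))"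
      by (rule nn_integral_has_integral_lebesgue[OF _ int]) (use div profile_bounds(1) in auto)
    finally show ?thesis
      unfolding unif using False nonneg ge
      by (simp add: divide_ennreal indicator_def flip: ennreal_1 ennreal_plus)
  qed
qed


section \<open>Counting the selections\<close>

lemma ennreal_of_enat_eq_suminf:
  "ennreal_of_enat N = (\<Sum>n::nat. if enat n < N then 1 else 0)"
proof -
  have "(\<lambda>n::nat. if enat n < N then 1 else 0 :: ennreal) sums ennreal_of_enat N"
    using sums_If_finite[of "\<lambda>n. enat n < N" "\<lambda>_. 1 :: ennreal"]
    by (cases N) (simp_all add: sums_def of_nat_tendsto_top_ennreal)
  then show ?thesis by (simp add: sums_iff)
qed

text \<open>
  With factors at least \<open>1\<close> the partial products increase, so the threshold has been passed
  within \<open>n\<close> selections exactly when the product of the first \<open>n\<close> exceeds it. For \<open>n = 0\<close>, where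
  no selection has been made, the equivalence relies on \<open>t \<ge> 0\<close>.
\<close>

lemma less_num_selections_iff:
  assumes "t \<ge> 0" and ge: "\<And>i. i \<ge> 1 \<Longrightarrow> z i \<ge> 1"
  shows "enat n < num_selections z t \<longleftrightarrow> (\<Prod>i=1..n. z i) \<le> exp t"
proof
  assume less: "enat n < num_selections z t"
  show "(\<Prod>i=1..n. z i) \<le> exp t"
  proof (rule ccontr)
    assume "\<not> (\<Prod>i=1..n. z i) \<le> exp t"
    then have "n \<in> {n. 1 \<le> n \<and> (\<Prod>i=1..n. z i) > exp t}"
      using assms by (cases n) auto
    then have "num_selections z t \<le> enat n"
      unfolding num_selections_def by (intro Inf_lower imageI)
    with less show False by simp
  qed
next
  assume le: "(\<Prod>i=1..n. z i) \<le> exp t"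
  have "enat (Suc n) \<le> num_selections z t"
    unfolding num_selections_def
  proof (rule Inf_greatest, clarsimp)
    fix m assume m: "Suc 0 \<le> m" "exp t < (\<Prod>i=Suc 0..m. z i)"
    show "Suc n \<le> m"
    proof (rule ccontr)
      assume "\<not> Suc n \<le> m"
      then have "(\<Prod>i=1..m. z i) \<le> (\<Prod>i=1..n. z i)"
        using ge by (intro prod_mono2) (auto intro: order_trans[of 0 1])
      with le m show False by simp
    qed
  qed
  then show "enat n < num_selections z t"
    by (simp add: Suc_ile_eq)
qed


section \<open>The expected number of selections\<close>

text \<open>
  The telescoping argument. In the proof \<open>p n\<close> is the probability that the first \<open>n\<close> selections
  do not pass the threshold, and \<open>R n\<close> is the remainder of the sum of the \<open>p i\<close> after \<open>n\<close> terms.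
\<close>

lemma expected_selections_eq_late:
  fixes M :: "'a measure" and Z :: "nat \<Rightarrow> 'a \<Rightarrow> real" and t :: real
  assumes "prob_space M"
    and "prob_space.indep_vars M (\<lambda>_. borel) Z {1..}"
    and "\<And>i. i \<ge> 1 \<Longrightarrow> distr M borel (Z i) = uniform_measure lborel {1..exp 1}"
    and "t \<in> {1..2}"
  shows "expected_selections M Z t = ennreal (late t)"
proof -
  interpret prob_space M by fact
  define \<mu> :: "real measure" where "\<mu> = uniform_measure lborel {1..exp 1}"
  define P where "P n \<omega> = (\<Prod>i=1..n. Z i \<omega>)" for n \<omega>
  define x where "x = exp t"
  define C where "C = 2 + exp (2 * (exp 1 / (exp 1 - 1)) :: real)"
  define p where "p n = prob {\<omega> \<in> space M. P n \<omega> \<le> x}" for n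
  define R where "R n = (\<integral>\<^sup>+ \<omega>. ennreal (profile (x / P n \<omega>)) \<partial>M)" for n
  have t: "1 \<le> t" "t \<le> 2" using assms(4) by auto
  have x: "exp 1 \<le> x" "x \<le> exp 2" "x \<ge> 1" using t by (auto simp: x_def)
  have Z_meas [measurable]: "Z i \<in> borel_measurable M" if "i \<ge> 1" for i
    using assms(2) that unfolding indep_vars_def by auto
  have P_meas [measurable]: "P n \<in> borel_measurable M" for n
    unfolding P_def [abs_def] by (intro borel_measurable_prod) auto
  have "AE \<omega> in M. \<forall>i\<in>{1..}. Z i \<omega> \<ge> 1"
  proof (subst AE_ball_countable, simp, intro ballI)
    fix i :: nat assume i: "i \<in> {1..}"
    then have [measurable]: "Z i \<in> borel_measurable M" by auto
    have "AE z in \<mu>. z \<ge> 1"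
      unfolding \<mu>_def by (rule AE_uniform_measureI) auto
    then have "AE z in distr M borel (Z i). z \<ge> 1"
      using assms(3)[of i] i unfolding \<mu>_def by (simp only: atLeast_iff)
    then show "AE \<omega> in M. Z i \<omega> \<ge> 1"
      by (subst (asm) AE_distr_iff) auto
  qed
  then have AE_Z: "AE \<omega> in M. \<forall>i\<ge>1. Z i \<omega> \<ge> 1"
    by (simp only: Ball_def atLeast_iff)
  have P_ge: "P n \<omega> \<ge> 1" if "\<forall>i\<ge>1. Z i \<omega> \<ge> 1" for n \<omega>
    unfolding P_def using that by (intro prod_ge_1) auto
  have frac: "x / P n \<omega> \<le> exp 2" "(1 \<le> x / P n \<omega>) = (P n \<omega> \<le> x)"
    if "\<forall>i\<ge>1. Z i \<omega> \<ge> 1" for n \<omega>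
  proof -
    have 1: "P n \<omega> \<ge> 1" using that by (rule P_ge)
    then have "x / P n \<omega> \<le> x / 1" using x by (intro divide_left_mono) auto
    with x show "x / P n \<omega> \<le> exp 2" by simp
    show "(1 \<le> x / P n \<omega>) = (P n \<omega> \<le> x)"
      using 1 by (simp add: le_divide_eq)
  qed
  have p_eq: "ennreal (p n) = (\<integral>\<^sup>+ \<omega>. indicator {..x} (P n \<omega>) \<partial>M)" for n
  proof -
    have "(\<integral>\<^sup>+ \<omega>. indicator {..x} (P n \<omega>) \<partial>M)
        = (\<integral>\<^sup>+ \<omega>. indicator {\<omega> \<in> space M. P n \<omega> \<le> x} \<omega> \<partial>M)"
      by (intro nn_integral_cong) (auto simp: indicator_def)
    then show ?thesis
      by (simp add: p_def emeasure_eq_measure)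
  qed

  have indep: "\<mu> \<Otimes>\<^sub>M distr M borel (P n) = distr M (borel \<Otimes>\<^sub>M borel) (\<lambda>\<omega>. (Z (Suc n) \<omega>, P n \<omega>))" for n
  proof -
    have "indep_var borel (Z (Suc n)) borel (\<lambda>\<omega>. \<Prod>i\<in>{1..n}. Z i \<omega>)"
      by (rule indep_vars_prod) (auto intro: indep_vars_subset[OF assms(2)])
    then have "indep_var borel (Z (Suc n)) borel (P n)"
      by (simp only: P_def [abs_def])
    then show ?thesis
      using assms(3)[of "Suc n"] by (simp add: indep_var_distribution_eq \<mu>_def)
  qed
  (* the uniform measure is the law of the first selection, hence a probability measure *)
  have sf: "sigma_finite_measure \<mu>"
    unfolding \<mu>_def using assms(3)[of 1] prob_space_distr[OF Z_meas[of 1]]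
    by (metis order_refl prob_space_imp_sigma_finite)
  have sets_\<mu> [measurable_cong]: "sets \<mu> = sets borel"
    by (simp add: \<mu>_def)

  (* conditioning on the first n selections: integrate out the next one by Tonelli *)
  have R_step: "R n = ennreal (p n) + R (Suc n)" for n
  proof -
    have [measurable]: "Z (Suc n) \<in> borel_measurable M" by simp
    interpret \<mu>: sigma_finite_measure \<mu> by (rule sf)
    interpret pair: pair_sigma_finite \<mu> "distr M borel (P n)"
      by (intro pair_sigma_finite.intro sf prob_space_imp_sigma_finite prob_space_distr P_meas)
    have "R (Suc n) = (\<integral>\<^sup>+ \<omega>. ennreal (profile (x / P n \<omega> / Z (Suc n) \<omega>)) \<partial>M)"
      by (simp add: R_def P_def)
    also have "\<dots> = (\<integral>\<^sup>+ (z, q). ennreal (profile (x / q / z))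
        \<partial>distr M (borel \<Otimes>\<^sub>M borel) (\<lambda>\<omega>. (Z (Suc n) \<omega>, P n \<omega>)))"
      by (subst nn_integral_distr) auto
    also have "\<dots> = (\<integral>\<^sup>+ q. (\<integral>\<^sup>+ z. ennreal (profile (x / q / z)) \<partial>\<mu>) \<partial>distr M borel (P n))"
      unfolding indep[symmetric] by (subst pair.nn_integral_snd[symmetric]) auto
    also have "\<dots> = (\<integral>\<^sup>+ \<omega>. (\<integral>\<^sup>+ z. ennreal (profile (x / P n \<omega> / z)) \<partial>\<mu>) \<partial>M)"
      by (subst nn_integral_distr) (auto intro!: \<mu>.borel_measurable_nn_integral)
    finally have "ennreal (p n) + R (Suc n) = (\<integral>\<^sup>+ \<omega>. indicator {..x} (P n \<omega>) +
        (\<integral>\<^sup>+ z. ennreal (profile (x / P n \<omega> / z)) \<partial>\<mu>) \<partial>M)"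
      unfolding p_eq by (subst nn_integral_add) (auto intro!: \<mu>.borel_measurable_nn_integral)
    also have "\<dots> = R n"
      unfolding R_def
    proof (rule nn_integral_cong_AE, use AE_Z in eventually_elim)
      case (elim \<omega>)
      show ?case
        using profile_renewal[OF frac(1)[OF elim, of n]] frac(2)[OF elim, of n]
        by (simp add: \<mu>_def indicator_def)
    qed
    finally show ?thesis ..
  qed

  have R_le: "R n \<le> ennreal (C * p n)" for n
  proof -
    have "R n \<le> (\<integral>\<^sup>+ \<omega>. ennreal C * indicator {..x} (P n \<omega>) \<partial>M)"
      unfolding R_def
    proof (rule nn_integral_mono_AE, use AE_Z in eventually_elim)
      case (elim \<omega>)
      have "profile (x / P n \<omega>) \<le> C * indicator {..x} (P n \<omega>)"
        using profile_bounds(2)[OF frac(1)[OF elim, of n]] frac(2)[OF elim, of n]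
        by (simp add: C_def indicator_def)
      then have "ennreal (profile (x / P n \<omega>)) \<le> ennreal (C * indicator {..x} (P n \<omega>))"
        by (rule ennreal_leI)
      also have "\<dots> = ennreal C * indicator {..x} (P n \<omega>)"
        by (simp add: indicator_def)
      finally show ?case .
    qed
    also have "\<dots> = ennreal C * ennreal (p n)"
      unfolding p_eq by (rule nn_integral_cmult) auto
    finally show ?thesis
      by (simp add: ennreal_mult C_def p_def)
  qed

  (* at t = 1 the profile is given by its early branch, which agrees with the late one there *)
  have profile_x: "profile x = late t"
  proof (cases "t = 1")
    case True
    then show ?thesis
      by (simp add: profile_def x_def early_1_eq_late_1)
  next
    case False
    with t show ?thesis by (simp add: profile_def x_def)
  qed
  have R_0: "R 0 = ennreal (late t)"
    by (simp add: R_def P_def profile_x emeasure_space_1)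

  have telescope: "ennreal (late t) = ennreal (\<Sum>i<n. p i) + R n" for n
  proof (induction n)
    case (Suc n)
    then show ?case
      using R_step[of n]
      by (simp add: p_def sum_nonneg add.assoc)
  qed (simp add: R_0)

  have late_nonneg: "late t \<ge> 0" using late_bounds(1) t by simp
  have partial_le: "(\<Sum>i<n. p i) \<le> late t" for n
  proof -
    have "ennreal (\<Sum>i<n. p i) \<le> ennreal (late t)"
      using telescope[of n] by simp
    then show ?thesis using late_nonneg by simp
  qed
  have summable: "summable p"
    using partial_le by (intro summableI_nonneg_bounded[of p "late t"]) (auto simp: p_def)
  have "(\<lambda>n. C * p n) \<longlonglongrightarrow> C * 0"
    by (intro tendsto_mult tendsto_const summable_LIMSEQ_zero summable)
  then have "(\<lambda>n. ennreal (C * p n)) \<longlonglongrightarrow> ennreal 0"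
    by (intro tendsto_ennrealI) simp
  then have lim: "(\<lambda>n. ennreal (C * p n)) \<longlonglongrightarrow> 0" by simp
  have R_lim: "R \<longlonglongrightarrow> 0"
    by (rule tendsto_sandwich[OF _ _ tendsto_const lim]) (simp_all add: R_le)
  have "(\<lambda>n. ennreal (\<Sum>i<n. p i) + R n) \<longlonglongrightarrow> ennreal (suminf p) + 0"
    by (intro tendsto_add R_lim tendsto_ennrealI summable_LIMSEQ summable)
  then have sum: "ennreal (suminf p) = ennreal (late t)"
    unfolding telescope[symmetric] by (simp add: LIMSEQ_const_iff)

  have "expected_selections M Z t = (\<integral>\<^sup>+ \<omega>. (\<Sum>n. indicator {..x} (P n \<omega>)) \<partial>M)"
    unfolding expected_selections_def
  proof (rule nn_integral_cong_AE, use AE_Z in eventually_elim)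
    case (elim \<omega>)
    have "(if enat n < num_selections (\<lambda>i. Z i \<omega>) t then 1 else 0) = (indicator {..x} (P n \<omega>) :: ennreal)" for n
      using less_num_selections_iff[of t "\<lambda>i. Z i \<omega>" n] elim t by (simp add: P_def x_def)
    then show ?case
      by (simp add: ennreal_of_enat_eq_suminf)
  qed
  also have "\<dots> = (\<Sum>n. ennreal (p n))"
    unfolding p_eq by (rule nn_integral_suminf) simp
  also have "\<dots> = ennreal (late t)"
    using summable sum by (subst suminf_ennreal2) (auto simp: p_def)
  finally show ?thesis .
qed

theorem theorem6:
  fixes M :: "'a measure" and Z :: "nat \<Rightarrow> 'a \<Rightarrow> real" and t :: real
  assumes "prob_space M"
    and "prob_space.indep_vars M (\<lambda>_. borel) Z {1..}"
    and "\<And>i. i \<ge> 1 \<Longrightarrow> distr M borel (Z i) = uniform_measure lborel {1..exp 1}"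
    and "t \<in> {1..2}"
  shows "expected_selections M Z t =
    (let e = exp 1 :: real in
      ennreal
        (exp (e / (e - 1) * t) *
           (- ((e - 1) / exp (2 + 1 / (e - 1))) + 1 / e + exp (- (e / (e - 1))) / (e - 1))
         + 2 * (e - 1) / e
         - exp (- (e / (e - 1))) * t * exp (e / (e - 1) * t) / (e - 1)))"
proof -
  define e :: real where "e = exp 1"
  have e: "e > 1" by (simp add: e_def)
  (* the only discrepancy with the coefficients of late: 2 + 1 / (e - 1) = 1 + e / (e - 1) *)
  have "exp (2 + 1 / (e - 1)) = e * exp (e / (e - 1))"
  proof -
    have "2 + 1 / (e - 1) = 1 + e / (e - 1)" using e by (simp add: field_simps)
    then have "exp (2 + 1 / (e - 1)) = exp (1 + e / (e - 1))" by (simp only:)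
    then show ?thesis by (simp only: exp_add e_def)
  qed
  then have coeff: "(e - 1) / exp (2 + 1 / (e - 1)) = exp (- (e / (e - 1))) * ((e - 1) / e)"
    by (simp add: exp_minus divide_inverse)
  have "late t = exp (e / (e - 1) * t) *
           (- ((e - 1) / exp (2 + 1 / (e - 1))) + 1 / e + exp (- (e / (e - 1))) / (e - 1))
         + 2 * (e - 1) / e
         - exp (- (e / (e - 1))) * t * exp (e / (e - 1) * t) / (e - 1)"
    unfolding coeff late_def exp_affine_def e_def[symmetric]
    by (simp add: right_diff_distrib distrib_left mult_ac)
  moreover have "expected_selections M Z t = ennreal (late t)"
    by (rule expected_selections_eq_late) (fact assms)+
  ultimately show ?thesis
    by (simp only: Let_def e_def)
qed

end
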